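(* Let $G_0,G_1\in\mathbb{Z}$, let $(G_n)_{n\ge0}$ satisfy $G_n=G_{n-1}+G_{n-2}$ for $n\ge2$, let $k$ be a positive integer and $m\ge2$ an integer. Then $\pi_{G_0,G_1}(m)$ divides $k$ if and only if $m$ divides $\mathcal{G}_{G_0,G_1}(k)$.
   Context: $\mathcal{G}_{G_0,G_1}(k)$ is the greatest common divisor of all integers $\sum_{i=0}^{k-1}G_{n+i}$, $n\ge1$. For $m\ge2$, the generalized Pisano period $\pi_{G_0,G_1}(m)$ is the smallest positive integer $r$ with $G_r\equiv G_0\pmod m$ and $G_{r+1}\equiv G_1\pmod m$. *)

theory Defs
  imports "HOL-Number_Theory.Cong"
begin

fun gen_fib :: "int \<Rightarrow> int \<Rightarrow> nat \<Rightarrow> int" where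
  "gen_fib G0 G1 0 = G0"
| "gen_fib G0 G1 (Suc 0) = G1"
| "gen_fib G0 G1 (Suc (Suc n)) = gen_fib G0 G1 (Suc n) + gen_fib G0 G1 n"

text \<open>The Gcd of the infinite set is the nonnegative generator of the ideal spanned by it;
  it is 0 exactly when all the sums vanish.\<close>

definition gcd_sums :: "int \<Rightarrow> int \<Rightarrow> nat \<Rightarrow> int" where
  "gcd_sums G0 G1 k = Gcd {(\<Sum>i=0..<k. gen_fib G0 G1 (n + i)) | n. n \<ge> 1}"

text \<open>For \<open>m \<ge> 2\<close> the recurrence is invertible modulo \<open>m\<close>, so the sequence is purely
  periodic and the least element exists.\<close>

definition gen_pisano :: "int \<Rightarrow> int \<Rightarrow> int \<Rightarrow> nat" where
  "gen_pisano G0 G1 m = (LEAST r. r > 0 \<and>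
     [gen_fib G0 G1 r = G0] (mod m) \<and> [gen_fib G0 G1 (r + 1) = G1] (mod m))"

end

theory Submission
  imports Defs
begin

text \<open>Consecutive sums telescope: \<open>G\<^sub>n + \<dots> + G\<^sub>n\<^sub>+\<^sub>k\<^sub>-\<^sub>1 = G\<^sub>n\<^sub>+\<^sub>k\<^sub>+\<^sub>1 - G\<^sub>n\<^sub>+\<^sub>1\<close>. Hence \<open>m\<close>
  divides all of them iff the sequence is \<open>k\<close>-periodic modulo \<open>m\<close> from index 2 on, and, since the
  recurrence can be run backwards, iff it is \<open>k\<close>-periodic from index 0 on. The periods are the
  multiples of the least one.\<close>

definition gen_fib_period :: "int \<Rightarrow> int \<Rightarrow> int \<Rightarrow> nat \<Rightarrow> bool" where
  "gen_fib_period G0 G1 m r \<longleftrightarrow> (\<forall>n. [gen_fib G0 G1 (n + r) = gen_fib G0 G1 n] (mod m))"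

lemma sum_gen_fib:
  "(\<Sum>i=0..<k. gen_fib a b (n + i)) = gen_fib a b (Suc (n + k)) - gen_fib a b (Suc n)"
  by (induction k) auto

text \<open>Given \<open>?S\<close>, adding it to \<open>?R\<close> yields \<open>?T\<close> by the
  recurrence, and subtracting it from \<open>?T\<close> recovers \<open>?R\<close>, so a step can be
  undone modulo \<open>m\<close>.\<close>

lemma gen_fib_cong_pair_Suc_iff:
  "[gen_fib a b (Suc i) = gen_fib a b (Suc j)] (mod m) \<and>
   [gen_fib a b (Suc (Suc i)) = gen_fib a b (Suc (Suc j))] (mod m) \<longleftrightarrow>
   [gen_fib a b i = gen_fib a b j] (mod m) \<and>
   [gen_fib a b (Suc i) = gen_fib a b (Suc j)] (mod m)"
  (is "?S \<and> ?T \<longleftrightarrow> ?R \<and> ?S")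
proof -
  have "?T \<longleftrightarrow> ?R" if ?S
    using cong_add[OF that] cong_diff[OF _ that,
        of "gen_fib a b (Suc (Suc i))" "gen_fib a b (Suc (Suc j))"]
    by auto
  then show ?thesis by blast
qed

lemma gen_fib_cong_pair_shift_iff:
  "[gen_fib a b (n + i) = gen_fib a b (n + j)] (mod m) \<and>
   [gen_fib a b (Suc (n + i)) = gen_fib a b (Suc (n + j))] (mod m) \<longleftrightarrow>
   [gen_fib a b i = gen_fib a b j] (mod m) \<and>
   [gen_fib a b (Suc i) = gen_fib a b (Suc j)] (mod m)"
proof (induction n)
  case (Suc n)
  then show ?case
    using gen_fib_cong_pair_Suc_iff[of a b "n + i" "n + j" m] by simp
qed simp

lemma gen_fib_period_iff_cong_pair:
  "gen_fib_period a b m r \<longleftrightarrow>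
   [gen_fib a b (n + r) = gen_fib a b n] (mod m) \<and>
   [gen_fib a b (Suc (n + r)) = gen_fib a b (Suc n)] (mod m)"
proof
  assume "gen_fib_period a b m r"
  then show "[gen_fib a b (n + r) = gen_fib a b n] (mod m) \<and>
    [gen_fib a b (Suc (n + r)) = gen_fib a b (Suc n)] (mod m)"
    unfolding gen_fib_period_def by (metis add_Suc)
next
  assume *: "[gen_fib a b (n + r) = gen_fib a b n] (mod m) \<and>
    [gen_fib a b (Suc (n + r)) = gen_fib a b (Suc n)] (mod m)"
  show "gen_fib_period a b m r"
    unfolding gen_fib_period_def
  proof
    fix l
    \<comment> \<open>The first instance moves the congruent pair from \<open>n\<close> down to
      index 0, the second moves it up to \<open>l\<close>.\<close>
    show "[gen_fib a b (l + r) = gen_fib a b l] (mod m)"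
      using * gen_fib_cong_pair_shift_iff[of a b n r 0 m]
        gen_fib_cong_pair_shift_iff[of a b l r 0 m] by simp
  qed
qed

lemma gen_pisano_eq_Least_period:
  "gen_pisano a b m = (LEAST r. r > 0 \<and> gen_fib_period a b m r)"
  unfolding gen_pisano_def gen_fib_period_iff_cong_pair[of a b m _ 0] by simp

text \<open>Pigeonhole: there are only finitely many pairs of residues, so two consecutive pairs
  agree at some \<open>i < j\<close>. Such an agreement at \<open>i\<close> already makes
  \<open>j - i\<close> a period from index 0 on.\<close>

lemma ex_gen_fib_period:
  assumes "m > 0"
  shows "\<exists>r>0. gen_fib_period a b m r"
proof -
  let ?f = "\<lambda>n. (gen_fib a b n mod m, gen_fib a b (Suc n) mod m)"
  have "range ?f \<subseteq> {0..<m} \<times> {0..<m}"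
    using assms by auto
  then have "finite (range ?f)"
    by (rule finite_subset) simp
  then have "\<not> inj ?f"
    using finite_imageD by blast
  then obtain i j where "i < j" "?f i = ?f j"
    unfolding inj_def by (metis (no_types, lifting) nat_neq_iff)
  then have "gen_fib_period a b m (j - i)"
    unfolding gen_fib_period_iff_cong_pair[of a b m _ i] by (simp add: cong_def)
  with \<open>i < j\<close> show ?thesis
    by (meson zero_less_diff)
qed

text \<open>The direction from left to right cancels a period, which is what allows reducing
  \<open>k\<close> modulo \<open>p\<close> later.\<close>

lemma gen_fib_period_add_iff:
  assumes "gen_fib_period a b m p"
  shows "gen_fib_period a b m (r + p) \<longleftrightarrow> gen_fib_period a b m r"
  using assms unfolding gen_fib_period_def
  by (metis add.assoc cong_trans cong_sym)

lemma gen_fib_period_add_mult_iff: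
  assumes "gen_fib_period a b m p"
  shows "gen_fib_period a b m (r + q * p) \<longleftrightarrow> gen_fib_period a b m r"
proof (induction q)
  case (Suc q)
  then show ?case
    using gen_fib_period_add_iff[OF assms, of "r + q * p"] by (simp add: ac_simps)
qed simp

lemma gen_pisano_dvd_iff:
  assumes "m > 0"
  shows "gen_pisano a b m dvd k \<longleftrightarrow> gen_fib_period a b m k"
proof -
  let ?P = "\<lambda>r. r > 0 \<and> gen_fib_period a b m r"
  define p where "p = gen_pisano a b m"
  have p_Least: "p = (LEAST r. ?P r)"
    by (simp add: p_def gen_pisano_eq_Least_period)
  have p: "p > 0" "gen_fib_period a b m p"
    using LeastI_ex[of ?P] ex_gen_fib_period[OF assms] unfolding p_Least by blast+
  have "gen_fib_period a b m k \<longleftrightarrow> gen_fib_period a b m (k mod p)"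
    using gen_fib_period_add_mult_iff[OF p(2), of "k mod p" "k div p"] by simp
  \<comment> \<open>The remainder is below \<open>p\<close>, so by minimality it cannot be a
    positive period; conversely, 0 is trivially a period.\<close>
  also have "\<dots> \<longleftrightarrow> k mod p = 0"
    using not_less_Least[of "k mod p" ?P] p(1) mod_less_divisor[of p k]
    unfolding p_Least[symmetric] by (auto simp: gen_fib_period_def)
  finally show ?thesis
    by (simp add: p_def dvd_eq_mod_eq_0)
qed

lemma dvd_gcd_sums_iff:
  "m dvd gcd_sums a b k \<longleftrightarrow> gen_fib_period a b m k"
proof -
  have "m dvd gcd_sums a b k \<longleftrightarrow>
    (\<forall>n\<ge>1. [gen_fib a b (Suc n + k) = gen_fib a b (Suc n)] (mod m))"
    unfolding gcd_sums_def dvd_Gcd_iff sum_gen_fib by (auto simp: cong_iff_dvd_diff)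
  also have "\<dots> \<longleftrightarrow> gen_fib_period a b m k"
  proof
    assume *: "\<forall>n\<ge>1. [gen_fib a b (Suc n + k) = gen_fib a b (Suc n)] (mod m)"
    show "gen_fib_period a b m k"
      \<comment> \<open>The sums start at \<open>n = 1\<close>, so telescoping says nothing directly
        about indices 0 and 1. The cases \<open>n = 1\<close> and \<open>n = 2\<close> give the
        consecutive pair at indices 2 and 3, which suffices.\<close>
      unfolding gen_fib_period_iff_cong_pair[of a b m k 2]
      using *[rule_format, of 1] *[rule_format, of 2] by (simp add: eval_nat_numeral)
  qed (auto simp only: gen_fib_period_def)
  finally show ?thesis .
qed

theorem theorem3p10:
  fixes G0 G1 m :: int and k :: nat
  assumes "k > 0" and "m \<ge> 2"
  shows "gen_pisano G0 G1 m dvd k \<longleftrightarrow> m dvd gcd_sums G0 G1 k"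
  using assms by (simp add: gen_pisano_dvd_iff dvd_gcd_sums_iff)

end
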